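(* For all nonnegative integers $n$, $a$, $\Delta$ such that $n \geq 2\Delta$ and $\Delta \leq a \leq n - \Delta$, \[ F(n,a,\Delta) \geq \binom{n-2\Delta}{a-\Delta}. \]
   Context: For a finite graph $G$, a permutation of the vertices of $G$ is a sequence listing every vertex of $G$ exactly once; two such permutations $\pi,\sigma$ are $G$-different if there is an index $i$ such that $\{\pi(i),\sigma(i)\}$ is an edge of $G$; $F(G)$ denotes the maximum size of a family of pairwise $G$-different permutations of the vertices of $G$. For a subgraph $G$ of $K_{a,n-a}$ on the same $n$ vertices (with the same bipartition), the bipartite complement of $G$ is the graph on the same vertices whose edges are the edges of $K_{a,n-a}$ not in $G$. $F(n,a,\Delta)$ denotes the minimum of $F(G)$ over all $n$-vertex bipartite graphs $G$ that are subgraphs of $K_{a,n-a}$ and whose bipartite complement has maximum degree $\Delta$. *)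

theory Defs
  imports Complex_Main "HOL-Combinatorics.Multiset_Permutations"
begin

text \<open>
  A finite simple graph is given by its vertex set \<open>V\<close> and its set \<open>E\<close> of two-element edges.
  A permutation of the vertices is a list from \<open>permutations_of_set V\<close>, i.e. a
  distinct list whose set of entries is \<open>V\<close>.
\<close>

definition graph_different :: "'a set set \<Rightarrow> 'a list \<Rightarrow> 'a list \<Rightarrow> bool" where
  "graph_different E \<pi> \<sigma> \<longleftrightarrow>
     (\<exists>i. i < length \<pi> \<and> i < length \<sigma> \<and> {\<pi> ! i, \<sigma> ! i} \<in> E)"

text \<open>For finite \<open>V\<close> the maximum below is over a finite set containing \<open>0\<close>.\<close>

definition max_different :: "'a set \<Rightarrow> 'a set set \<Rightarrow> nat" where
  "max_different V E =
     Max {card P | P. P \<subseteq> permutations_of_set V \<and> pairwise (graph_different E) P}"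

definition complete_bipartite :: "'a set \<Rightarrow> 'a set \<Rightarrow> 'a set set" where
  "complete_bipartite A B = {{x, y} | x y. x \<in> A \<and> y \<in> B}"

definition bipartite_complement :: "'a set \<Rightarrow> 'a set \<Rightarrow> 'a set set \<Rightarrow> 'a set set" where
  "bipartite_complement A B E = complete_bipartite A B - E"

definition degree :: "'a set set \<Rightarrow> 'a \<Rightarrow> nat" where
  "degree E v = card {e \<in> E. v \<in> e}"

text \<open>
  On finite nonempty sets of naturals \<open>Sup\<close> is the maximum; as \<open>Sup {} = 0\<close>, the graph without
  vertices has maximum degree \<open>0\<close>.
\<close>

definition max_degree :: "'a set \<Rightarrow> 'a set set \<Rightarrow> nat" where
  "max_degree V E = (SUP v\<in>V. degree E v)"

text \<open>
  Vertices are natural numbers, which covers all finite graphs up to isomorphism. On nonempty sets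
  of naturals \<open>Inf\<close> is the minimum; its value on the empty set is unspecified. The definition is
  meant for \<open>a \<le> n\<close>, as \<open>n - a\<close> is truncated otherwise.
\<close>

definition min_max_different :: "nat \<Rightarrow> nat \<Rightarrow> nat \<Rightarrow> nat" where
  "min_max_different n a \<Delta> =
     Inf {max_different (A \<union> B) E | (A :: nat set) (B :: nat set) E.
       finite A \<and> finite B \<and> A \<inter> B = {} \<and> card A = a \<and> card B = n - a \<and>
       E \<subseteq> complete_bipartite A B \<and>
       max_degree (A \<union> B) (bipartite_complement A B E) = \<Delta>}"

end

theory Submission
  imports Defs
begin

text \<open>
  If \<open>{x, y}\<close> is an edge, permutations starting with \<open>x\<close> are different from permutations starting
  with \<open>y\<close>, so the maximum for \<open>G\<close> is at least the sum of those for \<open>G - x\<close> and \<open>G - y\<close>.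
  Deleting vertices does not increase degrees in the bipartite complement, and an edge exists as
  long as both sides have more than \<open>\<Delta>\<close> vertices, so the bound follows from Pascal's rule.
\<close>

lemma graph_different_Cons:
  "graph_different E (x # \<pi>) (y # \<sigma>) \<longleftrightarrow> {x, y} \<in> E \<or> graph_different E \<pi> \<sigma>"
proof -
  have "(\<exists>i. Q i) \<longleftrightarrow> Q 0 \<or> (\<exists>i. Q (Suc i))" for Q :: "nat \<Rightarrow> bool"
    by (metis old.nat.exhaust)
  from this[of "\<lambda>i. i < length (x # \<pi>) \<and> i < length (y # \<sigma>) \<and> {(x # \<pi>) ! i, (y # \<sigma>) ! i} \<in> E"]
  show ?thesis
    unfolding graph_different_def by simp
qed

lemma graph_different_family_Un:
  assumes P: "P \<subseteq> permutations_of_set (V - {x})" "pairwise (graph_different E) P"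
    and Q: "Q \<subseteq> permutations_of_set (V - {y})" "pairwise (graph_different E) Q"
    and xy: "x \<in> V" "y \<in> V" "x \<noteq> y" "{x, y} \<in> E"
  obtains R where "R \<subseteq> permutations_of_set V" "pairwise (graph_different E) R"
    "card R = card P + card Q"
proof
  let ?R = "(#) x ` P \<union> (#) y ` Q"
  show "?R \<subseteq> permutations_of_set V"
    using P(1) Q(1) xy by (auto simp: permutations_of_set_def)
  show "pairwise (graph_different E) ?R"
    using P(2) Q(2) xy(4) unfolding pairwise_def ball_Un ball_simps(9)
    by (simp add: graph_different_Cons insert_commute)
  have "finite P" "finite Q"
    using P(1) Q(1) by (auto intro: finite_subset)
  then show "card ?R = card P + card Q"
    using xy(3) by (subst card_Un_disjoint) (auto simp: card_image)
qed

text \<open>Writing the sizes as \<open>i + \<Delta>\<close> and \<open>j + \<Delta>\<close> lets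
  the induction run on \<open>i + j\<close> with \<open>\<Delta>\<close> fixed. An upper bound on
  non-neighbours, unlike an exact maximum degree, survives the deletion of vertices; it is asked of
  \<open>A\<close>, the side from which the edge is chosen.\<close>

lemma graph_different_family_exists:
  fixes A B :: "'a set"
  assumes "finite A" "finite B" "A \<inter> B = {}"
    and "card A = i + \<Delta>" "card B = j + \<Delta>"
    and "\<And>x. x \<in> A \<Longrightarrow> card {y \<in> B. {x, y} \<notin> E} \<le> \<Delta>"
  shows "\<exists>P. P \<subseteq> permutations_of_set (A \<union> B) \<and> pairwise (graph_different E) P
           \<and> card P = (i + j) choose i"
  using assms
proof (induction "i + j" arbitrary: i j A B rule: less_induct)
  case less
  show ?case
  proof (cases "i = 0 \<or> j = 0")
    \<comment> \<open>The binomial coefficient is 1 here, so any single permutation is a suitable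
      family.\<close>
    case True
    obtain \<pi> where "\<pi> \<in> permutations_of_set (A \<union> B)"
      using finite_distinct_list[of "A \<union> B"] less.prems(1,2)
      by (auto intro: permutations_of_setI)
    with True show ?thesis
      by (intro exI[of _ "{\<pi>}"]) auto
  next
    case False
    then obtain i' j' where ij: "i = Suc i'" "j = Suc j'"
      using not0_implies_Suc by blast
    obtain x where x: "x \<in> A"
      using less.prems ij by fastforce
    \<comment> \<open>As \<open>j > 0\<close>, \<open>B\<close> has more than
      \<open>\<Delta>\<close> vertices, and at most \<open>\<Delta>\<close> of them are
      non-neighbours of \<open>x\<close>.\<close>
    have "\<exists>y\<in>B. {x, y} \<in> E"
    proof (rule ccontr)
      assume "\<not> ?thesis"
      then have "{y \<in> B. {x, y} \<notin> E} = B" by blast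
      with less.prems(5,6) x ij show False by fastforce
    qed
    then obtain y where y: "y \<in> B" "{x, y} \<in> E" by blast
    have 1: "A - {x} \<union> B = A \<union> B - {x}" and 2: "A \<union> (B - {y}) = A \<union> B - {y}"
      using x y less.prems by auto
    obtain P where P: "P \<subseteq> permutations_of_set (A \<union> B - {x})" "pairwise (graph_different E) P"
        "card P = (i' + j) choose i'"
      using less.hyps[of i' j "A - {x}" B] less.prems x unfolding 1 by (auto simp: ij)
    \<comment> \<open>Deleting \<open>x\<close> only drops an instance of the bound, but deleting
      \<open>y\<close> shrinks the sets being counted.\<close>
    have "card {v \<in> B - {y}. {u, v} \<notin> E} \<le> \<Delta>" if "u \<in> A" for u
      by (rule order.trans[OF card_mono less.prems(6)[OF that]]) (use less.prems(2) in auto)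
    then obtain Q where Q: "Q \<subseteq> permutations_of_set (A \<union> B - {y})"
        "pairwise (graph_different E) Q" "card Q = (i + j') choose i"
      using less.hyps[of i j' A "B - {y}"] less.prems y unfolding 2 by (auto simp: ij)
    \<comment> \<open>Both \<open>i' + j\<close> and \<open>i + j'\<close> equal
      \<open>i + j - 1\<close>, so the two sizes add up by Pascal's rule; \<open>x\<close> and
      \<open>y\<close> differ because \<open>A\<close> and \<open>B\<close> are disjoint.\<close>
    show ?thesis
      using graph_different_family_Un[OF P(1,2) Q(1,2)] x y P(3) Q(3) less.prems(3)
      by (metis IntI UnCI add_Suc add_Suc_right binomial_Suc_Suc empty_iff ij)
  qed
qed

lemma card_le_max_different:
  assumes "P \<subseteq> permutations_of_set V" "pairwise (graph_different E) P"
  shows "card P \<le> max_different V E"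
  unfolding max_different_def
proof (rule Max_ge)
  show "finite {card P | P. P \<subseteq> permutations_of_set V \<and> pairwise (graph_different E) P}"
    by (rule finite_subset[of _ "card ` Pow (permutations_of_set V)"]) auto
qed (use assms in auto)

lemma finite_complete_bipartite:
  assumes "finite A" "finite B"
  shows "finite (complete_bipartite A B)"
  by (rule finite_subset[of _ "Pow (A \<union> B)"]) (use assms in \<open>auto simp: complete_bipartite_def\<close>)

lemma degree_complete_bipartite:
  assumes "finite A" "finite B" "A \<inter> B = {}"
  shows "x \<in> A \<Longrightarrow> degree (complete_bipartite A B) x = card B"
    and "y \<in> B \<Longrightarrow> degree (complete_bipartite A B) y = card A"
proof -
  assume x: "x \<in> A"
  have "{e \<in> complete_bipartite A B. x \<in> e} = (\<lambda>y. {x, y}) ` B"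
    using x assms(3) unfolding complete_bipartite_def by blast
  then show "degree (complete_bipartite A B) x = card B"
    by (auto simp: degree_def card_image inj_on_def doubleton_eq_iff)
next
  assume y: "y \<in> B"
  have "{e \<in> complete_bipartite A B. y \<in> e} = (\<lambda>x. {x, y}) ` A"
    using y assms(3) unfolding complete_bipartite_def by blast
  then show "degree (complete_bipartite A B) y = card A"
    by (auto simp: degree_def card_image inj_on_def doubleton_eq_iff)
qed

text \<open>Distinct non-neighbours \<open>y\<close> of \<open>x\<close> in \<open>B\<close> give
  distinct edges \<open>{x, y}\<close> of the bipartite complement at \<open>x\<close>.\<close>

lemma non_neighbours_le_max_degree:
  assumes "finite A" "finite B" "x \<in> A"
  shows "card {y \<in> B. {x, y} \<notin> E} \<le> max_degree (A \<union> B) (bipartite_complement A B E)"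
proof -
  let ?H = "bipartite_complement A B E"
  have "card {y \<in> B. {x, y} \<notin> E} = card ((\<lambda>y. {x, y}) ` {y \<in> B. {x, y} \<notin> E})"
    by (rule card_image[symmetric]) (auto simp: inj_on_def doubleton_eq_iff)
  also have "\<dots> \<le> degree ?H x"
    unfolding degree_def
  proof (rule card_mono)
    show "finite {e \<in> ?H. x \<in> e}"
      using finite_complete_bipartite[OF assms(1,2)] by (simp add: bipartite_complement_def)
  qed (use assms(3) in \<open>auto simp: bipartite_complement_def complete_bipartite_def\<close>)
  also have "\<dots> \<le> max_degree (A \<union> B) ?H"
    unfolding max_degree_def by (rule cSUP_upper) (use assms in auto)
  finally show ?thesis .
qed

lemma binomial_le_max_different:
  assumes "finite A" "finite B" "A \<inter> B = {}"
    and "max_degree (A \<union> B) (bipartite_complement A B E) = \<Delta>"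
    and "\<Delta> \<le> card A" "\<Delta> \<le> card B"
  shows "(card A + card B - 2 * \<Delta>) choose (card A - \<Delta>) \<le> max_different (A \<union> B) E"
proof -
  have "\<exists>P. P \<subseteq> permutations_of_set (A \<union> B) \<and> pairwise (graph_different E) P
          \<and> card P = ((card A - \<Delta>) + (card B - \<Delta>)) choose (card A - \<Delta>)"
    using assms non_neighbours_le_max_degree[OF assms(1,2)]
    by (intro graph_different_family_exists) auto
  moreover have "(card A - \<Delta>) + (card B - \<Delta>) = card A + card B - 2 * \<Delta>"
    using assms(5,6) by simp
  ultimately show ?thesis
    using card_le_max_different by metis
qed

text \<open>The graph is a balanced complete bipartite graph plus isolated vertices, so every degree
  is \<open>\<Delta>\<close> or 0.\<close>

lemma max_degree_complete_bipartite_balanced: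
  assumes "finite A" "finite B" "A' \<subseteq> A" "B' \<subseteq> B" "A \<inter> B = {}" "card A' = \<Delta>" "card B' = \<Delta>"
  shows "max_degree (A \<union> B) (complete_bipartite A' B') = \<Delta>"
proof -
  have fin: "finite A'" "finite B'" "A' \<inter> B' = {}"
    using assms by (auto intro: finite_subset)
  have deg: "degree (complete_bipartite A' B') v = (if v \<in> A' \<union> B' then \<Delta> else 0)" for v
  proof (cases "v \<in> A' \<union> B'")
    case True
    then show ?thesis
      using degree_complete_bipartite[OF fin] assms(6,7) by auto
  next
    case False
    then have "{e \<in> complete_bipartite A' B'. v \<in> e} = {}"
      unfolding complete_bipartite_def by blast
    then show ?thesis
      using False by (simp only: degree_def card.empty if_False)
  qed
  show ?thesis
  \<comment> \<open>For \<open>\<Delta> = 0\<close> there may be no vertices at all, and then the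
    value rests on \<open>Sup {} = 0\<close>. Otherwise a vertex of \<open>A'\<close> attains the
    maximum.\<close>
  proof (cases "\<Delta> = 0")
    case True
    then have "degree (complete_bipartite A' B') = (\<lambda>_. 0)"
      by (simp add: deg fun_eq_iff)
    then show ?thesis
      using True by (cases "A \<union> B = {}") (simp_all add: max_degree_def)
  next
    case False
    then obtain v where v: "v \<in> A'"
      using assms(6) by fastforce
    then show ?thesis
      unfolding max_degree_def using assms(3)
      by (intro cSup_eq_maximum image_eqI[of _ _ v]) (auto simp: deg)
  qed
qed

text \<open>This makes the set under \<open>Inf\<close> in \<open>min_max_different\<close>
  nonempty, without which its value would be unspecified.\<close>

lemma exists_graph_max_degree_bipartite_complement:
  assumes "2 * \<Delta> \<le> n" "\<Delta> \<le> a" "a \<le> n - \<Delta>"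
  shows "\<exists>(A :: nat set) (B :: nat set) E.
       finite A \<and> finite B \<and> A \<inter> B = {} \<and> card A = a \<and> card B = n - a \<and>
       E \<subseteq> complete_bipartite A B \<and>
       max_degree (A \<union> B) (bipartite_complement A B E) = \<Delta>"
proof -
  let ?A = "{..<a}" and ?B = "{a..<n}"
  \<comment> \<open>This is the intended complement; it fits because both sides have at least
    \<open>\<Delta>\<close> vertices. The graph itself is the complete bipartite graph minus
    \<open>?H\<close>.\<close>
  let ?H = "complete_bipartite {..<\<Delta>} {a..<a + \<Delta>}"
  have "?H \<subseteq> complete_bipartite ?A ?B"
    using assms by (fastforce simp: complete_bipartite_def)
  then have "bipartite_complement ?A ?B (complete_bipartite ?A ?B - ?H) = ?H"
    by (auto simp: bipartite_complement_def)
  moreover have "max_degree (?A \<union> ?B) ?H = \<Delta>"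
    by (rule max_degree_complete_bipartite_balanced) (use assms in auto)
  ultimately show ?thesis
    by (intro exI[of _ ?A] exI[of _ ?B] exI[of _ "complete_bipartite ?A ?B - ?H"]) auto
qed

theorem theorem2:
  fixes n a \<Delta> :: nat
  assumes "n \<ge> 2 * \<Delta>" and "\<Delta> \<le> a" and "a \<le> n - \<Delta>"
  shows "min_max_different n a \<Delta> \<ge> (n - 2 * \<Delta>) choose (a - \<Delta>)"
  unfolding min_max_different_def
proof (rule cInf_greatest, goal_cases)
  case 1
  then show ?case
    using exists_graph_max_degree_bipartite_complement[OF assms] by blast
next
  case (2 m)
  then obtain A B :: "nat set" and E where *: "m = max_different (A \<union> B) E" "finite A" "finite B"
      "A \<inter> B = {}" "card A = a" "card B = n - a"
      "max_degree (A \<union> B) (bipartite_complement A B E) = \<Delta>"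
    by blast
  have "a + (n - a) = n" "\<Delta> \<le> n - a"
    using assms by linarith+
  with binomial_le_max_different[OF *(2-4,7)] * assms show ?case
    by simp
qed

end
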